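(* Let $p$ be an odd prime. Let $A$ be a zero-sum-free sequence of length $2p-2$ over $\mathbb F_p^2$, and let $u\in\mathbb F_p^2$, $u\ne 0$. Suppose that every nonempty subsequence of $A$ with sum $u$ is a singleton (i.e. has length $1$). Then $u$ occurs exactly $p-1$ times in $A$.
   Context: A sequence over an abelian group is a finite unordered list of elements, with repetitions allowed (a finite multiset); its length counts multiplicity. A sequence is zero-sum-free if no nonempty subsequence has sum zero. *)

theory Defs
  imports
    "Berlekamp_Zassenhaus.Finite_Field"
    "HOL-Analysis.Finite_Cartesian_Product"
    "HOL-Library.Multiset"
begin

definition zero_sum_free :: "'g::ab_group_add multiset \<Rightarrow> bool" where
  "zero_sum_free A \<longleftrightarrow> (\<forall>B. B \<subseteq># A \<and> B \<noteq> {#} \<longrightarrow> sum_mset B \<noteq> 0)"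

end

theory Submission
  imports Defs
begin

text \<open>
  For a function \<open>f\<close> on an abelian group write \<open>\<Delta>\<^sub>a f (v) = f v - f (v - a)\<close>.  Applying
  \<open>\<Delta>\<^sub>a\<close> for all terms \<open>a\<close> of a sequence \<open>A\<close> to the indicator function of \<open>0\<close>
  gives the signed subset-sum count
  \<open>F v = \<Sum> (-1)\<^bsup>length B\<^esup>\<close>, the sum ranging over the subsequences \<open>B\<close> of \<open>A\<close> with sum \<open>v\<close>
  (one for each choice of positions, so equal terms are told apart).

  Over \<open>\<bbbF>\<^sub>p\<^sup>n\<close>, with values taken in \<open>\<bbbF>\<^sub>p\<close>, the indicator of \<open>0\<close> is the polynomial
  \<open>\<Prod>\<^sub>i (1 - v\<^sub>i\<^bsup>p-1\<^esup>)\<close> of degree \<open>n (p - 1)\<close>, and each \<open>\<Delta>\<^sub>a\<close> lowers the degree.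
  Hence \<open>F\<close> is constant as soon as \<open>A\<close> has \<open>n (p - 1)\<close> terms
  (\<open>iterated_difference_zero_indicator\<close>).
  If \<open>A\<close> is zero-sum-free, only the empty subsequence contributes to \<open>F 0\<close>, so \<open>F 0 = 1\<close>; if
  moreover only singletons sum to \<open>u\<close>, then \<open>F u\<close> is minus the multiplicity of \<open>u\<close>.
  So this multiplicity is \<open>-1\<close> modulo \<open>p\<close>, and it is less than \<open>p\<close> because \<open>p\<close> copies of \<open>u\<close>
  sum to zero.
\<close>

definition difference :: "'g::ab_group_add \<Rightarrow> ('g \<Rightarrow> 'r::comm_ring_1) \<Rightarrow> 'g \<Rightarrow> 'r" where
  "difference a f v = f v - f (v - a)"

text \<open>
  The functions annihilated by any \<open>k\<close> successive differences: an intrinsic form of ``polynomial of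
  degree less than \<open>k\<close>'', which does not depend on the choice of a representing polynomial.
\<close>

fun degree_less :: "nat \<Rightarrow> ('g::ab_group_add \<Rightarrow> 'r::comm_ring_1) \<Rightarrow> bool" where
  "degree_less 0 f \<longleftrightarrow> f = (\<lambda>_. 0)"
| "degree_less (Suc k) f \<longleftrightarrow> (\<forall>a. degree_less k (difference a f))"

lemma degree_less_SucI: "degree_less k f \<Longrightarrow> degree_less (Suc k) f"
proof (induction k arbitrary: f)
  case 0
  then show ?case by (simp add: difference_def fun_eq_iff)
next
  case (Suc k)
  then show ?case by auto
qed

lemma degree_less_mono: "k \<le> m \<Longrightarrow> degree_less k f \<Longrightarrow> degree_less m f"
  by (induction rule: dec_induct) (blast intro: degree_less_SucI)+

lemma degree_less_add:
  "degree_less k f \<Longrightarrow> degree_less k g \<Longrightarrow> degree_less k (\<lambda>v. f v + g v)"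
proof (induction k arbitrary: f g)
  case (Suc k)
  have "difference a (\<lambda>v. f v + g v) = (\<lambda>v. difference a f v + difference a g v)" for a
    by (simp add: difference_def fun_eq_iff algebra_simps)
  with Suc show ?case by simp
qed simp

lemma degree_less_cmult: "degree_less k f \<Longrightarrow> degree_less k (\<lambda>v. c * f v)"
proof (induction k arbitrary: f)
  case (Suc k)
  have "difference a (\<lambda>v. c * f v) = (\<lambda>v. c * difference a f v)" for a
    by (simp add: difference_def fun_eq_iff algebra_simps)
  with Suc show ?case by simp
qed simp

lemma degree_less_diff:
  assumes "degree_less k f" "degree_less k g"
  shows "degree_less k (\<lambda>v. f v - g v)"
  using degree_less_add[OF assms(1) degree_less_cmult[OF assms(2), of "-1"]] by simp

lemma degree_less_translate: "degree_less k f \<Longrightarrow> degree_less k (\<lambda>v. f (v - b))"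
proof (induction k arbitrary: f)
  case (Suc k)
  have "difference a (\<lambda>v. f (v - b)) = (\<lambda>v. difference a f (v - b))" for a
    by (simp add: difference_def fun_eq_iff algebra_simps)
  with Suc show ?case by simp
qed simp

text \<open>
  The Leibniz rule
  \<open>\<Delta>\<^sub>a (l f) (v) = l v * \<Delta>\<^sub>a f v + l a * f (v - a)\<close>: a linear factor costs at most one degree.
\<close>

lemma degree_less_additive_mult:
  assumes l: "\<And>v w. l (v - w) = l v - l w"
  shows "degree_less k f \<Longrightarrow> degree_less (Suc k) (\<lambda>v. l v * f v)"
proof (induction k arbitrary: f)
  case 0
  then show ?case by (simp add: difference_def fun_eq_iff)
next
  case (Suc k)
  have "difference a (\<lambda>v. l v * f v) = (\<lambda>v. l v * difference a f v + l a * f (v - a))" for a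
    by (simp add: difference_def l fun_eq_iff algebra_simps)
  moreover have "degree_less (Suc k) (\<lambda>v. l v * difference a f v + l a * f (v - a))" for a
    using Suc.prems
    by (intro degree_less_add Suc.IH degree_less_cmult degree_less_translate) simp_all
  ultimately show ?case
    by (simp only: degree_less.simps(2)[of "Suc k"]) simp
qed

lemma degree_less_additive_power_mult:
  assumes l: "\<And>v w. l (v - w) = l v - l w" and f: "degree_less k f"
  shows "degree_less (k + m) (\<lambda>v. l v ^ m * f v)"
proof (induction m)
  case (Suc m)
  then show ?case
    using degree_less_additive_mult[OF l, of "k + m" "\<lambda>v. l v ^ m * f v"]
    by (simp add: mult.assoc del: degree_less.simps)
qed (simp add: f)

text \<open>
  Since \<open>(1 - v\<^sub>i\<^sup>m) f = f - v\<^sub>i\<^sup>m f\<close>, each factor costs at most \<open>m\<close> degrees.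
\<close>

lemma degree_less_prod_coordinates:
  assumes "finite S"
  shows "degree_less (Suc (card S * m)) (\<lambda>v::'r::comm_ring_1 ^ 'n. \<Prod>i\<in>S. 1 - (v $ i) ^ m)"
  using assms
proof (induction S)
  case empty
  then show ?case by (simp add: difference_def fun_eq_iff)
next
  case (insert i S)
  let ?f = "\<lambda>v::'r ^ 'n. \<Prod>i\<in>S. 1 - (v $ i) ^ m"
  let ?k = "Suc (card S * m)"
  have "degree_less (?k + m) (\<lambda>v. (v $ i) ^ m * ?f v)"
    by (rule degree_less_additive_power_mult) (simp_all add: insert.IH del: degree_less.simps)
  moreover have "degree_less (?k + m) ?f"
    by (rule degree_less_mono[OF _ insert.IH]) simp
  ultimately have "degree_less (?k + m) (\<lambda>v. ?f v - (v $ i) ^ m * ?f v)"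
    by (intro degree_less_diff)
  then show ?case
    using insert.hyps by (simp add: algebra_simps del: degree_less.simps)
qed

definition zero_indicator :: "'g::ab_group_add \<Rightarrow> 'r::comm_ring_1" where
  "zero_indicator v = (if v = 0 then 1 else 0)"

text \<open>
  By Fermat's little theorem each factor is the indicator of a hyperplane \<open>v\<^sub>i = 0\<close>, and these
  hyperplanes intersect in the origin.
\<close>

lemma zero_indicator_eq_prod:
  fixes v :: "'p::prime_card mod_ring ^ 'n"
  shows "zero_indicator v = (\<Prod>i\<in>UNIV. 1 - (v $ i) ^ (CARD('p) - 1))"
proof (cases "v = 0")
  case True
  have "CARD('p) > 1" using prime_card[where 'a = 'p] prime_gt_1_nat by blast
  with True show ?thesis by (simp add: zero_indicator_def zero_power)
next
  case False
  then obtain i where i: "v $ i \<noteq> 0" by (auto simp: vec_eq_iff)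
  then have "(v $ i) ^ (CARD('p) - 1) = 1"
    using finite_field_power_card_eq_same[of "v $ i"]
    by (simp add: power_eq_if[of _ "CARD('p)"])
  then have "(\<Prod>i\<in>UNIV. 1 - (v $ i) ^ (CARD('p) - 1)) = 0"
    by (intro prod_zero) auto
  with False show ?thesis by (simp add: zero_indicator_def)
qed

lemma degree_less_foldr_difference:
  "degree_less (k + length xs) f \<Longrightarrow> degree_less k (foldr difference xs f)"
proof (induction xs arbitrary: k)
  case (Cons a xs)
  from Cons.IH[of "Suc k"] Cons.prems show ?case by simp
qed simp

lemma iterated_difference_zero_indicator:
  fixes xs :: "('p::prime_card mod_ring ^ 'n) list" and v w :: "'p mod_ring ^ 'n"
  assumes "length xs = CARD('n) * (CARD('p) - 1)"
  defines "F \<equiv> foldr difference xs (zero_indicator :: _ \<Rightarrow> 'p mod_ring)"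
  shows "F v = F w"
proof -
  have "degree_less (Suc (length xs)) (zero_indicator :: 'p mod_ring ^ 'n \<Rightarrow> 'p mod_ring)"
    unfolding zero_indicator_eq_prod[abs_def] assms(1)
    by (rule degree_less_prod_coordinates) simp
  then have "degree_less 1 F"
    unfolding F_def by (intro degree_less_foldr_difference) simp
  then have "difference (v - w) F v = 0" by simp
  then show ?thesis by (simp add: difference_def)
qed

lemma foldr_difference_Cons:
  "foldr difference (a # xs) f v = foldr difference xs f v - foldr difference xs f (v - a)"
  by (simp only: foldr.simps o_apply difference_def[of a])

text \<open>
  The values of the signed subset-sum count are read off by induction on the sequence, not from its
  expansion as a sum: by the recursion \<open>foldr_difference_Cons\<close>, the subsequences with sum \<open>v\<close>
  that contain the first term \<open>a\<close> contribute minus the count at \<open>v - a\<close>.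
\<close>

lemma signed_count_eq_0:
  assumes "\<And>B. B \<subseteq># mset xs \<Longrightarrow> sum_mset B \<noteq> v"
  shows "foldr difference xs zero_indicator v = 0"
  using assms
proof (induction xs arbitrary: v)
  case Nil
  then show ?case using Nil[of "{#}"] by (auto simp: zero_indicator_def)
next
  case (Cons a xs)
  have "sum_mset B \<noteq> v" if "B \<subseteq># mset xs" for B
    using Cons.prems[of B] that by (simp add: subset_mset.order_trans[OF that])
  moreover have "sum_mset B \<noteq> v - a" if "B \<subseteq># mset xs" for B
    using Cons.prems[of "add_mset a B"] that by (auto simp: algebra_simps)
  ultimately show ?case
    using Cons.IH by (simp add: foldr_difference_Cons del: foldr.simps)
qed

lemma zero_sum_free_subset: "zero_sum_free A \<Longrightarrow> B \<subseteq># A \<Longrightarrow> zero_sum_free B"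
  unfolding zero_sum_free_def using subset_mset.order_trans by blast

lemma signed_count_0:
  assumes "zero_sum_free (mset xs)"
  shows "foldr difference xs zero_indicator 0 = (1 :: 'r::comm_ring_1)"
  using assms
proof (induction xs)
  case Nil
  then show ?case by (simp add: zero_indicator_def)
next
  case (Cons a xs)
  have "sum_mset B \<noteq> 0 - a" if "B \<subseteq># mset xs" for B
  proof -
    from Cons.prems that have "sum_mset (add_mset a B) \<noteq> 0"
      unfolding zero_sum_free_def by (metis add_mset_not_empty mset.simps(2) mset_subset_eq_add_mset_cancel)
    then show ?thesis by auto
  qed
  then have "foldr difference xs zero_indicator (0 - a) = (0 :: 'r)"
    by (rule signed_count_eq_0)
  moreover have "zero_sum_free (mset xs)"
    using Cons.prems by (rule zero_sum_free_subset) simp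
  ultimately show ?case
    using Cons.IH by (simp add: foldr_difference_Cons del: foldr.simps)
qed

text \<open>
  A first term equal to \<open>u\<close> contributes \<open>-1\<close>, the count at \<open>u - u = 0\<close> with its sign; any other
  first term contributes nothing, since it could only occur in a longer subsequence with sum \<open>u\<close>.
\<close>

lemma signed_count_singletons:
  fixes u :: "'g::ab_group_add"
  assumes "zero_sum_free (mset xs)" "u \<noteq> 0"
    and "\<And>B. B \<subseteq># mset xs \<Longrightarrow> B \<noteq> {#} \<Longrightarrow> sum_mset B = u \<Longrightarrow> size B = 1"
  shows "foldr difference xs zero_indicator u = (- of_nat (count (mset xs) u) :: 'r::comm_ring_1)"
  using assms
proof (induction xs)
  case Nil
  then show ?case by (simp add: zero_indicator_def)
next
  case (Cons a xs)
  have zsf: "zero_sum_free (mset xs)"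
    using Cons.prems(1) by (rule zero_sum_free_subset) simp
  have IH: "foldr difference xs zero_indicator u = (- of_nat (count (mset xs) u) :: 'r)"
  proof (rule Cons.IH[OF zsf \<open>u \<noteq> 0\<close>])
    fix B assume "B \<subseteq># mset xs" "B \<noteq> {#}" "sum_mset B = u"
    then show "size B = 1"
      using Cons.prems(3)[of B] by (simp add: subset_mset.order_trans[of B "mset xs"])
  qed
  show ?case
  proof (cases "a = u")
    case True
    then show ?thesis
      using IH signed_count_0[OF zsf, where ?'r = 'r] by (simp add: foldr_difference_Cons del: foldr.simps)
  next
    case False
    have "sum_mset B \<noteq> u - a" if B: "B \<subseteq># mset xs" for B
    proof
      assume sum: "sum_mset B = u - a"
      then have "size (add_mset a B) = 1"
        using B by (intro Cons.prems(3)) auto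
      with sum False show False by simp
    qed
    then have "foldr difference xs zero_indicator (u - a) = (0 :: 'r)"
      by (rule signed_count_eq_0)
    with IH False show ?thesis by (simp add: foldr_difference_Cons del: foldr.simps)
  qed
qed

lemma zero_sum_free_count_less:
  fixes A :: "('p::prime_card mod_ring ^ 'n) multiset"
  assumes "zero_sum_free A"
  shows "count A u < CARD('p)"
proof (rule ccontr)
  assume "\<not> count A u < CARD('p)"
  then have "replicate_mset CARD('p) u \<subseteq># A"
    by (simp add: count_le_replicate_mset_subset_eq[symmetric])
  moreover have "sum_mset (replicate_mset CARD('p) u) = 0"
  proof -
    have index: "sum_mset (replicate_mset k u) $ i = of_nat k * (u $ i)" for k i
      by (induction k) (simp_all add: algebra_simps)
    show ?thesis
      by (simp only: vec_eq_iff index of_nat_card_eq_0 mult_zero_left zero_index) simp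
  qed
  ultimately show False
    using assms unfolding zero_sum_free_def by fastforce
qed

theorem lemma4p4:
  fixes A :: "('p::prime_card mod_ring ^ 2) multiset"
    and u :: "'p mod_ring ^ 2"
  assumes "odd CARD('p)"
    and "zero_sum_free A"
    and "size A = 2 * CARD('p) - 2"
    and "u \<noteq> 0"
    and "\<And>B. B \<subseteq># A \<Longrightarrow> B \<noteq> {#} \<Longrightarrow> sum_mset B = u \<Longrightarrow> size B = 1"
  shows "count A u = CARD('p) - 1"
proof -
  obtain xs where xs: "mset xs = A" using ex_mset by blast
  let ?F = "foldr difference xs (zero_indicator :: _ \<Rightarrow> 'p mod_ring)"
  have "length xs = CARD(2) * (CARD('p) - 1)"
    using assms(3) by (simp flip: xs)
  then have "?F u = ?F 0"
    by (rule iterated_difference_zero_indicator)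
  moreover have "?F 0 = 1"
    using assms(2) by (intro signed_count_0) (simp add: xs)
  moreover have "?F u = - of_nat (count A u)"
    using assms(2,4,5) unfolding xs[symmetric] by (rule signed_count_singletons)
  ultimately have "of_nat (count A u + 1) = (0 :: 'p mod_ring)"
    by (metis add.right_inverse add.commute minus_minus of_nat_1 of_nat_add)
  then have "CARD('p) dvd count A u + 1"
    by (rule of_nat_0_mod_ring_dvd)
  then have "CARD('p) \<le> count A u + 1"
    by (rule dvd_imp_le) simp
  then show ?thesis
    using zero_sum_free_count_less[OF assms(2), of u] by linarith
qed

end
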